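(* Let $C>0$. Let $L_\infty(x,y)=\sum_{\ell,w\ge0}p_{\ell,w}x^\ell y^w$, where $p_{\ell,w}$ is the probability that a GSAW with nearest-neighbor weighting (with constant $C$) on $L_\infty$ terminates having taken exactly $\ell$ steps and having width $w$. Let $\underline{L}^*_\infty(x,y)=\sum_{\ell,w\ge0}\underline{p}^*_{\ell,w}x^\ell y^w$, where $\underline{p}^*_{\ell,w}$ is the corresponding probability for a GSAW with nearest-neighbor weighting on $\underline{L}^*_\infty$. Let $H(x,y)$ and $T(x,y)$ be the bivariate ordinary generating functions, by length (exponent of $x$) and width (exponent of $y$), of the probabilities that the first segment of a GSAW with nearest-neighbor weighting on $L_\infty$ is a hook path, respectively a twist path, of the given length and width. Then $$L_\infty(x,y)=\bigl(H(x,y)+T(x,y)\bigr)\,\underline{L}^*_\infty(x,y).$$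
   Context: $L_\infty$ is the graph with vertex set $\{(a,b): a\in\mathbb{Z},\ b\in\{1,2\}\}$, where $(a,b)$ and $(a',b')$ are adjacent iff ($b=b'$ and $|a-a'|=1$) or ($a=a'$ and $b\ne b'$). By symmetry walks on $L_\infty$ are taken to start at $(0,1)$. $E,W,N,S$ denote steps by $(1,0),(-1,0),(0,1),(0,-1)$. GSAW with nearest-neighbor weighting (constant $C>0$): if the path so far is $P=(v_1,\dots,v_n)$, each unvisited vertex $w$ has energy $E(w)=C^{k(w)}$, where $k(w)$ is the number of neighbors of $w$ lying in $P\setminus\{v_n\}$. The next vertex is chosen among the unvisited neighbors of $v_n$, with $w$ chosen with probability proportional to $E(w)$. The walk terminates when $v_n$ has no unvisited neighbor. Length is the number of steps; width is the difference between the largest and smallest $x$-coordinates on the path. $\underline{L}^*_\infty$: the half-infinite ladder with vertices $(a,b)$, $a\ge1$, $b\in\{1,2\}$ (same adjacency), where the walk starts at $(1,1)$ and the two additional vertices $(0,1),(0,2)$ to the left are adjoined and regarded as already visited (non-current) vertices of the path for the purpose of computing energies; they cannot be visited and are not counted in length or width. On $L_\infty$, up to left-right reflection: a hook path of order $n\ge0$ is $E^nNW^{n+1}$ (length $2n+2$, width $n+1$) and a twist path of order $n\ge0$ is $E^{n+1}NE$ (length $n+3$, width $n+2$). "The first segment is a hook (twist) path" means that the walk begins with such a step sequence or with its left-right mirror image (exchanging $E$ and $W$). *)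

theory Defs
  imports
    "HOL-Probability.Probability_Mass_Function"
    "HOL-Computational_Algebra.Formal_Power_Series"
    "HOL-Library.Sublist"
begin

type_synonym vertex = "int \<times> int"

fun ladder_adj :: "vertex \<Rightarrow> vertex \<Rightarrow> bool" where
  "ladder_adj (a, b) (a', b') \<longleftrightarrow> (b = b' \<and> \<bar>a - a'\<bar> = 1) \<or> (a = a' \<and> b \<noteq> b')"

definition ladder :: "vertex set" where
  "ladder = UNIV \<times> {1, 2}"

definition half_ladder :: "vertex set" where
  "half_ladder = {1..} \<times> {1, 2}"

definition left_vertices :: "vertex set" where
  "left_vertices = {0} \<times> {1, 2}"

text \<open>
  Growing self-avoiding walks: a path is the nonempty list of the vertices visited so far, in chronological order; its last
  element is the current vertex. In the following definitions, \<open>V\<close> is the set of vertices that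
  may be visited, and \<open>Z\<close> (disjoint from \<open>V\<close>) is a set of additional vertices that are never
  visited but count as already visited in the computation of energies.
\<close>

definition unvisited_nbrs :: "vertex set \<Rightarrow> vertex list \<Rightarrow> vertex set" where
  "unvisited_nbrs V P = {w \<in> V. ladder_adj (last P) w \<and> w \<notin> set P}"

definition trapped :: "vertex set \<Rightarrow> vertex list \<Rightarrow> bool" where
  "trapped V P \<longleftrightarrow> unvisited_nbrs V P = {}"

definition energy :: "real \<Rightarrow> vertex set \<Rightarrow> vertex list \<Rightarrow> vertex \<Rightarrow> real" where
  "energy C Z P w = C ^ card {u \<in> (set P - {last P}) \<union> Z. ladder_adj w u}"

definition next_vertex :: "real \<Rightarrow> vertex set \<Rightarrow> vertex set \<Rightarrow> vertex list \<Rightarrow> vertex pmf" where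
  "next_vertex C V Z P = embed_pmf (\<lambda>w.
     if w \<in> unvisited_nbrs V P
     then energy C Z P w / (\<Sum>u\<in>unvisited_nbrs V P. energy C Z P u) else 0)"

definition gsaw_step :: "real \<Rightarrow> vertex set \<Rightarrow> vertex set \<Rightarrow> vertex list \<Rightarrow> vertex list pmf" where
  "gsaw_step C V Z P =
     (if trapped V P then return_pmf P else map_pmf (\<lambda>w. P @ [w]) (next_vertex C V Z P))"

text \<open>
  The distribution of the path at time \<open>n\<close>, for the walk started at \<open>v\<close>. A walk that has
  terminated before time \<open>n\<close> keeps its final path, which then has fewer than \<open>n\<close> steps.
\<close>

primrec gsaw :: "real \<Rightarrow> vertex set \<Rightarrow> vertex set \<Rightarrow> vertex \<Rightarrow> nat \<Rightarrow> vertex list pmf" where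
  "gsaw C V Z v 0 = return_pmf [v]"
| "gsaw C V Z v (Suc n) = bind_pmf (gsaw C V Z v n) (gsaw_step C V Z)"

definition path_length :: "vertex list \<Rightarrow> nat" where
  "path_length P = length P - 1"

definition path_width :: "vertex list \<Rightarrow> nat" where
  "path_width P = nat (Max (fst ` set P) - Min (fst ` set P))"

text \<open>
  That a walk terminates after exactly \<open>l\<close> steps, or begins with a given segment of \<open>l\<close> steps,
  depends only on its path at time \<open>l\<close>. This is why both probabilities below are taken with
  respect to the distribution at that time.
\<close>

definition term_prob :: "real \<Rightarrow> vertex set \<Rightarrow> vertex set \<Rightarrow> vertex \<Rightarrow> nat \<Rightarrow> nat \<Rightarrow> real" where
  "term_prob C V Z v l w =
     measure_pmf.prob (gsaw C V Z v l) {P. trapped V P \<and> path_length P = l \<and> path_width P = w}"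

datatype dir = East | West | North | South

fun move :: "dir \<Rightarrow> vertex \<Rightarrow> vertex" where
  "move East (a, b) = (a + 1, b)"
| "move West (a, b) = (a - 1, b)"
| "move North (a, b) = (a, b + 1)"
| "move South (a, b) = (a, b - 1)"

fun path_of :: "vertex \<Rightarrow> dir list \<Rightarrow> vertex list" where
  "path_of v [] = [v]"
| "path_of v (d # ds) = v # path_of (move d v) ds"

fun mirror :: "dir \<Rightarrow> dir" where
  "mirror East = West"
| "mirror West = East"
| "mirror North = North"
| "mirror South = South"

definition hook :: "nat \<Rightarrow> dir list" where
  "hook n = replicate n East @ [North] @ replicate (n + 1) West"

definition twist :: "nat \<Rightarrow> dir list" where
  "twist n = replicate (n + 1) East @ [North, East]"

definition segments :: "(nat \<Rightarrow> dir list) \<Rightarrow> vertex list set" where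
  "segments s = (\<Union>n. {path_of (0, 1) (s n), path_of (0, 1) (map mirror (s n))})"

definition segment_prob :: "real \<Rightarrow> (nat \<Rightarrow> dir list) \<Rightarrow> nat \<Rightarrow> nat \<Rightarrow> real" where
  "segment_prob C s l w = measure_pmf.prob (gsaw C ladder {} (0, 1) l)
     {P. \<exists>Q\<in>segments s. path_length Q = l \<and> path_width Q = w \<and> prefix Q P}"

text \<open>
  Bivariate formal power series are series in \<open>x\<close> whose coefficients are series in \<open>y\<close>:
  the coefficient of \<open>x\<^sup>l y\<^sup>w\<close> in \<open>F\<close> is \<open>fps_nth (fps_nth F l) w\<close>.
\<close>

definition bivariate_gf :: "(nat \<Rightarrow> nat \<Rightarrow> real) \<Rightarrow> real fps fps" where
  "bivariate_gf p = Abs_fps (\<lambda>l. Abs_fps (\<lambda>w. p l w))"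

definition ladder_gf :: "real \<Rightarrow> real fps fps" where
  "ladder_gf C = bivariate_gf (term_prob C ladder {} (0, 1))"

definition half_ladder_star_gf :: "real \<Rightarrow> real fps fps" where
  "half_ladder_star_gf C = bivariate_gf (term_prob C half_ladder left_vertices (1, 1))"

definition hook_gf :: "real \<Rightarrow> real fps fps" where
  "hook_gf C = bivariate_gf (segment_prob C hook)"

definition twist_gf :: "real \<Rightarrow> real fps fps" where
  "twist_gf C = bivariate_gf (segment_prob C twist)"

lemma finite_unvisited_nbrs:
  assumes "V \<subseteq> ladder"
  shows "finite (unvisited_nbrs V P)"
proof -
  obtain a b where ab: "last P = (a, b)" by fastforce
  have "unvisited_nbrs V P \<subseteq> {a - 1..a + 1} \<times> {1, 2}"
    using assms by (auto simp: unvisited_nbrs_def ladder_def ab)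
  then show ?thesis
    by (rule finite_subset) auto
qed

lemma pmf_next_vertex:
  assumes "C > 0" "V \<subseteq> ladder" "\<not> trapped V P"
  shows "pmf (next_vertex C V Z P) w =
    (if w \<in> unvisited_nbrs V P
     then energy C Z P w / (\<Sum>u\<in>unvisited_nbrs V P. energy C Z P u) else 0)"
proof -
  let ?A = "unvisited_nbrs V P"
  let ?s = "\<Sum>u\<in>?A. energy C Z P u"
  have fin: "finite ?A" using assms(2) by (rule finite_unvisited_nbrs)
  have pos: "energy C Z P u > 0" for u
    using assms(1) by (simp add: energy_def)
  have s: "?s > 0"
    using fin pos assms(3) by (intro sum_pos) (auto simp: trapped_def)
  have nonneg: "0 \<le> (if u \<in> ?A then energy C Z P u / ?s else 0)" for u
    using pos[of u] s by auto
  have "(\<integral>\<^sup>+u. ennreal (if u \<in> ?A then energy C Z P u / ?s else 0) \<partial>count_space UNIV)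
      = (\<Sum>u\<in>?A. ennreal (if u \<in> ?A then energy C Z P u / ?s else 0))"
    by (rule nn_integral_count_space'[OF fin]) auto
  also have "\<dots> = ennreal (\<Sum>u\<in>?A. energy C Z P u / ?s)"
    using pos s by (subst sum_ennreal[symmetric]) (auto intro!: less_imp_le)
  also have "(\<Sum>u\<in>?A. energy C Z P u / ?s) = 1"
    using s by (simp flip: sum_divide_distrib)
  finally show ?thesis
    unfolding next_vertex_def using nonneg by (subst pmf_embed_pmf) auto
qed

end

theory Submission
  imports Defs
begin

text \<open>
  Until the walk has completed a hook or a twist it cannot be trapped. It runs straight, say east,
  and after its single turn north at column \<open>n\<close> it either steps on to the east, which completes a
  twist (or, if \<open>n = 0\<close>, a hook of order 0), or it turns back west. In the latter case it is confined to the
  row above its own trail, so it has only one choice per step, until it emerges beyond its starting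
  column and completes a hook. Therefore every terminated walk begins with a segment
  (\<open>gsaw_unfinished_or_segment\<close>, \<open>unfinished_not_trapped\<close>), and with only one
  (\<open>segments_prefix_free\<close>).

  At the end of a segment the walk is at a corner of an untouched half of the ladder, the column
  behind it is entirely visited, and nothing behind that column is reachable or adjacent to the
  untouched half. This is the starting position on the half ladder with its two extra visited
  vertices. So the continuation of the walk has exactly the law of a walk on the half ladder,
  transported by an isometry. This is proved step by step as an equality of distributions
  (\<open>gsaw_from_sealed\<close>). The isometry adds the lengths and the widths of the two parts
  (\<open>path_width_sealed\<close>). By the Markov property (\<open>prob_gsaw_prefix\<close>) the probability of
  terminating after a given segment is a product, and the sum over all segments
  (\<open>term_prob_ladder_eq_sum\<close>) is the Cauchy product of the two generating functions.
\<close>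

section \<open>Growing self-avoiding walks as a Markov chain\<close>

text \<open>
  The chain is started from an arbitrary path, because after a segment the walk continues with a
  nonempty past.
\<close>

primrec gsaw_from :: "real \<Rightarrow> vertex set \<Rightarrow> vertex set \<Rightarrow> vertex list \<Rightarrow> nat \<Rightarrow> vertex list pmf" where
  "gsaw_from C V Z P 0 = return_pmf P"
| "gsaw_from C V Z P (Suc n) = bind_pmf (gsaw_from C V Z P n) (gsaw_step C V Z)"

lemma gsaw_add: "gsaw C V Z v (m + n) = bind_pmf (gsaw C V Z v m) (\<lambda>P. gsaw_from C V Z P n)"
  by (induction n) (simp_all add: bind_return_pmf' bind_assoc_pmf)

lemma set_pmf_gsaw_step:
  assumes "C > 0" "V \<subseteq> ladder"
  shows "set_pmf (gsaw_step C V Z P) \<subseteq>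
    (if trapped V P then {P} else (\<lambda>w. P @ [w]) ` unvisited_nbrs V P)"
  using pmf_next_vertex[OF assms, of P Z]
  by (auto simp: gsaw_step_def set_pmf_iff split: if_splits)

lemma set_pmf_gsaw_SucE [consumes 3]:
  assumes "C > 0" "V \<subseteq> ladder" "P \<in> set_pmf (gsaw C V Z v (Suc n))"
  obtains (stay) "P \<in> set_pmf (gsaw C V Z v n)" "trapped V P"
  | (move) P' w where "P' \<in> set_pmf (gsaw C V Z v n)" "\<not> trapped V P'" "w \<in> unvisited_nbrs V P'"
      "P = P' @ [w]"
proof -
  obtain P' where P': "P' \<in> set_pmf (gsaw C V Z v n)" "P \<in> set_pmf (gsaw_step C V Z P')"
    using assms(3) by auto
  have "P \<in> (if trapped V P' then {P'} else (\<lambda>w. P' @ [w]) ` unvisited_nbrs V P')"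
    using set_pmf_gsaw_step[OF assms(1,2)] P'(2) by blast
  then show ?thesis using P'(1) that by (cases "trapped V P'") auto
qed

lemma length_gsaw:
  assumes "C > 0" "V \<subseteq> ladder" "P \<in> set_pmf (gsaw C V Z v n)"
  shows "P \<noteq> []" "length P \<le> Suc n" "length P = Suc n \<or> trapped V P"
proof -
  have "P \<noteq> [] \<and> length P \<le> Suc n \<and> (length P = Suc n \<or> trapped V P)"
    using assms(3)
  proof (induction n arbitrary: P)
    case (Suc n)
    from assms(1,2) Suc.prems show ?case
    proof (cases rule: set_pmf_gsaw_SucE)
      case stay
      then show ?thesis using Suc.IH[OF stay(1)] by auto
    next
      case (move P' w)
      then show ?thesis using Suc.IH[OF move(1)] by auto
    qed
  qed simp
  then show "P \<noteq> []" "length P \<le> Suc n" "length P = Suc n \<or> trapped V P" by auto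
qed

lemma gsaw_path_in:
  assumes "C > 0" "V \<subseteq> ladder" "v \<in> V" "P \<in> set_pmf (gsaw C V Z v n)"
  shows "set P \<subseteq> V" "v \<in> set P"
proof -
  have "set P \<subseteq> V \<and> v \<in> set P"
    using assms(4)
  proof (induction n arbitrary: P)
    case (Suc n)
    from assms(1,2) Suc.prems show ?case
    proof (cases rule: set_pmf_gsaw_SucE)
      case (move P' w)
      then show ?thesis using Suc.IH[OF move(1)] by (auto simp: unvisited_nbrs_def)
    qed (rule Suc.IH)
  qed (use assms(3) in simp)
  then show "set P \<subseteq> V" "v \<in> set P" by auto
qed

lemma prefix_gsaw_from:
  assumes "C > 0" "V \<subseteq> ladder" "P' \<in> set_pmf (gsaw_from C V Z P n)"
  shows "prefix P P'"
  using assms(3)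
proof (induction n arbitrary: P')
  case (Suc n)
  then obtain P'' where P'': "P'' \<in> set_pmf (gsaw_from C V Z P n)" "P' \<in> set_pmf (gsaw_step C V Z P'')"
    by auto
  have "P' \<in> (if trapped V P'' then {P''} else (\<lambda>w. P'' @ [w]) ` unvisited_nbrs V P'')"
    using set_pmf_gsaw_step[OF assms(1,2)] P''(2) by blast
  then show ?case using Suc.IH[OF P''(1)] by (auto split: if_splits)
qed simp

lemma gsaw_from_trapped:
  "trapped V P \<Longrightarrow> gsaw_from C V Z P n = return_pmf P"
  by (induction n) (simp_all add: bind_return_pmf gsaw_step_def)

text \<open>
  The Markov property at time \<open>k\<close>. The only path at time \<open>k\<close> that can grow into one with prefix \<open>Q\<close>
  is \<open>Q\<close> itself: a path of the same length is kept as a prefix, and a shorter path is trapped and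
  never changes again.
\<close>

lemma prob_gsaw_prefix:
  assumes "C > 0" "V \<subseteq> ladder" "length Q = Suc k"
    and E: "\<And>P. P \<in> E \<Longrightarrow> prefix Q P"
  shows "measure_pmf.prob (gsaw C V Z v (k + n)) E =
    pmf (gsaw C V Z v k) Q * measure_pmf.prob (gsaw_from C V Z Q n) E"
proof -
  let ?c = "emeasure (gsaw_from C V Z Q n) E"
  have other: "emeasure (gsaw_from C V Z P n) E = 0"
    if P: "P \<in> set_pmf (gsaw C V Z v k)" "P \<noteq> Q" for P
  proof -
    have "P' \<notin> E" if P': "P' \<in> set_pmf (gsaw_from C V Z P n)" for P'
    proof
      assume "P' \<in> E"
      then have Q: "prefix Q P'" by (rule E)
      from length_gsaw(3)[OF assms(1,2) P(1)] show False
      proof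
        assume "length P = Suc k"
        then show False
          using Q prefix_gsaw_from[OF assms(1,2) P'] P(2) assms(3)
          by (auto simp: prefix_def)
      next
        assume "trapped V P"
        then have "prefix Q P" using P' Q by (simp add: gsaw_from_trapped)
        then show False
          using P(2) length_gsaw(2)[OF assms(1,2) P(1)] assms(3) by (auto simp: prefix_def)
      qed
    qed
    then have "AE P' in gsaw_from C V Z P n. P' \<notin> E"
      by (simp add: AE_measure_pmf_iff)
    from emeasure_eq_0_AE[OF this] show ?thesis by simp
  qed
  have "emeasure (gsaw C V Z v (k + n)) E
      = (\<integral>\<^sup>+P. emeasure (gsaw_from C V Z P n) E \<partial>gsaw C V Z v k)"
    by (simp add: gsaw_add)
  also have "\<dots> = (\<integral>\<^sup>+P. ?c * indicator {Q} P \<partial>gsaw C V Z v k)"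
    by (intro nn_integral_cong_AE) (auto simp: AE_measure_pmf_iff other indicator_def)
  also have "\<dots> = ?c * pmf (gsaw C V Z v k) Q"
    by (subst nn_integral_cmult_indicator) (auto simp: emeasure_pmf_single)
  finally show ?thesis
    by (simp add: measure_def enn2real_mult)
qed

section \<open>Copies of the half ladder inside the ladder\<close>

text \<open>
  The isometry of the ladder that puts column 0 at column \<open>c\<close> and faces the direction \<open>s\<close>, which is
  1 or -1. The rows are exchanged because a segment ends in row 2 while the walk on the half
  ladder starts in row 1.
\<close>

definition frame :: "int \<Rightarrow> int \<Rightarrow> vertex \<Rightarrow> vertex" where
  "frame s c v = (c + s * fst v, 3 - snd v)"

lemma frame_props:
  assumes "\<bar>s\<bar> = 1"
  shows inj_frame: "inj (frame s c)" and surj_frame: "surj (frame s c)"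
    and ladder_adj_frame: "ladder_adj (frame s c u) (frame s c v) \<longleftrightarrow> ladder_adj u v"
    and frame_in_ladder: "frame s c v \<in> ladder \<longleftrightarrow> v \<in> ladder"
proof -
  have s: "s = 1 \<or> s = -1" using assms by auto
  show "inj (frame s c)" using s by (auto simp: inj_def frame_def prod_eq_iff)
  have "y = frame s c (s * (fst y - c), 3 - snd y)" for y
    using s by (auto simp: frame_def)
  then show "surj (frame s c)" by (rule surjI[OF sym])
  show "ladder_adj (frame s c u) (frame s c v) \<longleftrightarrow> ladder_adj u v"
    using s by (cases u; cases v) (auto simp: frame_def)
  show "frame s c v \<in> ladder \<longleftrightarrow> v \<in> ladder"
    by (cases v) (auto simp: frame_def ladder_def)
qed

text \<open>
  \<open>B\<close> is a segment without its last vertex. It contains the whole column 0 of the frame, so that the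
  half ladder ahead is cut off, and it occupies exactly the columns from \<open>-m\<close> to 0 of the frame, so
  that the half ladder ahead is untouched. The number of these columns is what it adds to the width.
\<close>

definition seals :: "int \<Rightarrow> int \<Rightarrow> nat \<Rightarrow> vertex list \<Rightarrow> bool" where
  "seals s c m B \<longleftrightarrow> \<bar>s\<bar> = 1 \<and> frame s c ` left_vertices \<subseteq> set B \<and>
     fst ` set B = (\<lambda>i. c - s * i) ` {0..int m}"

lemma seals_behind:
  assumes "seals s c m B" "frame s c v \<in> set B"
  shows "fst v \<le> 0"
proof -
  have "fst (frame s c v) \<in> (\<lambda>i. c - s * i) ` {0..int m}"
    using assms by (auto simp: seals_def)
  moreover have "s = 1 \<or> s = -1" using assms by (auto simp: seals_def)
  ultimately show ?thesis by (auto simp: frame_def)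
qed

text \<open>
  A neighbour of a vertex of the half ladder lies in the half ladder or in column 0. The latter is
  visited in both pictures.
\<close>

lemma unvisited_nbrs_sealed:
  assumes B: "seals s c m B" and R: "R \<noteq> []" "set R \<subseteq> half_ladder"
  shows "unvisited_nbrs ladder (B @ map (frame s c) R) = frame s c ` unvisited_nbrs half_ladder R"
proof -
  have s: "\<bar>s\<bar> = 1" using B by (simp add: seals_def)
  have mem: "frame s c v \<in> unvisited_nbrs ladder (B @ map (frame s c) R)
      \<longleftrightarrow> v \<in> unvisited_nbrs half_ladder R" (is "?l \<longleftrightarrow> ?r") for v
  proof -
    have last: "last R \<in> half_ladder" using R by auto
    have l: "?l \<longleftrightarrow> v \<in> ladder \<and> ladder_adj (last R) v \<and> v \<notin> set R \<and> frame s c v \<notin> set B"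
      using R(1) s by (auto simp: unvisited_nbrs_def last_map frame_in_ladder ladder_adj_frame
          inj_image_mem_iff[OF inj_frame])
    have "v \<in> left_vertices \<or> v \<in> half_ladder" if "v \<in> ladder" "ladder_adj (last R) v"
      using last that
      by (cases v; cases "last R") (auto simp: half_ladder_def left_vertices_def ladder_def)
    moreover have "frame s c v \<in> set B" if "v \<in> left_vertices"
      using B that by (auto simp: seals_def)
    moreover have "frame s c v \<notin> set B" if "v \<in> half_ladder"
      using seals_behind[OF B] that by (force simp: half_ladder_def)
    moreover have "half_ladder \<subseteq> ladder" by (auto simp: half_ladder_def ladder_def)
    ultimately show ?thesis unfolding l by (auto simp: unvisited_nbrs_def)
  qed
  show ?thesis
  proof (intro set_eqI)
    fix x
    obtain v where x: "x = frame s c v" using surjD[OF surj_frame[OF s]] by blast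
    show "x \<in> unvisited_nbrs ladder (B @ map (frame s c) R)
        \<longleftrightarrow> x \<in> frame s c ` unvisited_nbrs half_ladder R"
      unfolding x mem by (simp add: inj_image_mem_iff[OF inj_frame[OF s]])
  qed
qed

text \<open>
  A vertex in column 1 or beyond has no neighbour behind column 0. Hence the only vertices of \<open>B\<close> that
  contribute to its energy are the two in column 0, which are the additional vertices of the half
  ladder.
\<close>

lemma energy_sealed:
  assumes B: "seals s c m B" and R: "R \<noteq> []" "set R \<subseteq> half_ladder"
    and v: "v \<in> half_ladder"
  shows "energy C {} (B @ map (frame s c) R) (frame s c v) = energy C left_vertices R v"
proof -
  have s: "\<bar>s\<bar> = 1" using B by (simp add: seals_def)
  let ?P = "B @ map (frame s c) R"
  have mem: "frame s c u \<in> set ?P - {last ?P} \<and> ladder_adj v u \<longleftrightarrow>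
      u \<in> (set R - {last R}) \<union> left_vertices \<and> ladder_adj v u" for u
  proof -
    have "last R \<in> half_ladder" using R by auto
    then have l: "frame s c u \<in> set ?P - {last ?P} \<longleftrightarrow>
        u \<in> set R - {last R} \<or> frame s c u \<in> set B"
      using R(1) s seals_behind[OF B, of u]
      by (auto simp: last_map inj_image_mem_iff[OF inj_frame] inj_eq[OF inj_frame] half_ladder_def)
    have "u \<in> left_vertices" if "frame s c u \<in> set B" "ladder_adj v u"
      using seals_behind[OF B that(1)] that(2) v
      by (cases u; cases v) (auto simp: half_ladder_def left_vertices_def)
    moreover have "frame s c u \<in> set B" if "u \<in> left_vertices"
      using B that by (auto simp: seals_def)
    ultimately show ?thesis unfolding l by blast
  qed
  have "{x \<in> (set ?P - {last ?P}) \<union> {}. ladder_adj (frame s c v) x}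
      = frame s c ` {u \<in> (set R - {last R}) \<union> left_vertices. ladder_adj v u}" (is "?X = ?Y")
  proof (intro set_eqI)
    fix x
    obtain u where x: "x = frame s c u" using surjD[OF surj_frame[OF s]] by blast
    show "x \<in> ?X \<longleftrightarrow> x \<in> ?Y"
      using mem[of u]
      by (simp only: x inj_image_mem_iff[OF inj_frame[OF s]] mem_Collect_eq Un_empty_right
          ladder_adj_frame[OF s])
  qed
  then show ?thesis
    unfolding energy_def by (simp only: card_image[OF inj_on_subset[OF inj_frame[OF s] subset_UNIV]])
qed

text \<open>
  The frame maps the available vertices onto each other and preserves their energies, so it
  preserves the normalised weights.
\<close>

lemma gsaw_step_sealed:
  assumes C: "C > 0" and B: "seals s c m B" and R: "R \<noteq> []" "set R \<subseteq> half_ladder"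
  shows "gsaw_step C ladder {} (B @ map (frame s c) R) =
    map_pmf (\<lambda>R'. B @ map (frame s c) R') (gsaw_step C half_ladder left_vertices R)"
proof -
  let ?P = "B @ map (frame s c) R"
  have s: "\<bar>s\<bar> = 1" using B by (simp add: seals_def)
  have half: "half_ladder \<subseteq> ladder" by (auto simp: half_ladder_def ladder_def)
  note nbrs = unvisited_nbrs_sealed[OF B R]
  have tr: "trapped ladder ?P \<longleftrightarrow> trapped half_ladder R"
    by (simp add: trapped_def nbrs)
  show ?thesis
  proof (cases "trapped half_ladder R")
    case True
    then show ?thesis by (simp add: gsaw_step_def tr)
  next
    case False
    have en: "energy C {} ?P (frame s c v) = energy C left_vertices R v"
      if "v \<in> unvisited_nbrs half_ladder R" for v
      using that by (intro energy_sealed[OF B R]) (auto simp: unvisited_nbrs_def)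
    have total: "(\<Sum>u\<in>frame s c ` unvisited_nbrs half_ladder R. energy C {} ?P u)
        = (\<Sum>u\<in>unvisited_nbrs half_ladder R. energy C left_vertices R u)"
      by (subst sum.reindex) (auto intro: inj_on_subset[OF inj_frame[OF s]] simp: en)
    have "next_vertex C ladder {} ?P
        = map_pmf (frame s c) (next_vertex C half_ladder left_vertices R)"
    proof (rule pmf_eqI)
      fix x
      obtain v where x: "x = frame s c v" using surjD[OF surj_frame[OF s]] by blast
      show "pmf (next_vertex C ladder {} ?P) x
          = pmf (map_pmf (frame s c) (next_vertex C half_ladder left_vertices R)) x"
        using False
        by (simp add: x pmf_map_inj'[OF inj_frame[OF s]] pmf_next_vertex[OF C half]
            pmf_next_vertex[OF C order_refl] tr nbrs total en inj_image_mem_iff[OF inj_frame[OF s]])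
    qed
    then show ?thesis
      using False by (simp add: gsaw_step_def tr pmf.map_comp o_def)
  qed
qed

lemma gsaw_from_sealed:
  assumes C: "C > 0" and B: "seals s c m B"
  shows "gsaw_from C ladder {} (B @ [frame s c (1, 1)]) n =
    map_pmf (\<lambda>R. B @ map (frame s c) R) (gsaw C half_ladder left_vertices (1, 1) n)"
proof (induction n)
  case (Suc n)
  have half: "half_ladder \<subseteq> ladder" "(1, 1) \<in> half_ladder"
    by (auto simp: half_ladder_def ladder_def)
  have "gsaw_step C ladder {} (B @ map (frame s c) R) =
      map_pmf (\<lambda>R'. B @ map (frame s c) R') (gsaw_step C half_ladder left_vertices R)"
    if "R \<in> set_pmf (gsaw C half_ladder left_vertices (1, 1) n)" for R
    using length_gsaw(1)[OF C half(1) that] gsaw_path_in(1)[OF C half that]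
    by (intro gsaw_step_sealed[OF C B])
  then show ?case
    by (simp add: Suc.IH bind_map_pmf map_bind_pmf cong: bind_pmf_cong)
qed simp

lemma width_image:
  fixes A :: "int set"
  assumes "finite A" "A \<noteq> {}" "\<bar>s\<bar> = 1"
  shows "Max ((\<lambda>i. c + s * i) ` A) - Min ((\<lambda>i. c + s * i) ` A) = Max A - Min A"
proof -
  have "s = 1 \<or> s = -1" using assms(3) by auto
  then show ?thesis
  proof
    assume [simp]: "s = 1"
    have "Max ((\<lambda>i. c + s * i) ` A) = c + Max A"
      using assms(1,2) by (intro Max_eqI) auto
    moreover have "Min ((\<lambda>i. c + s * i) ` A) = c + Min A"
      using assms(1,2) by (intro Min_eqI) auto
    ultimately show ?thesis by simp
  next
    assume [simp]: "s = -1"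
    have "Max ((\<lambda>i. c + s * i) ` A) = c - Min A"
      using assms(1,2) by (intro Max_eqI) (auto intro: Min_in)
    moreover have "Min ((\<lambda>i. c + s * i) ` A) = c - Max A"
      using assms(1,2) by (intro Min_eqI) (auto intro: Max_in)
    ultimately show ?thesis by simp
  qed
qed

text \<open>
  In the coordinates of the frame, the columns of the whole path reach from \<open>-m\<close> to the last column
  of \<open>R\<close>, and those of \<open>R\<close> start at 1. With \<open>R = [(1, 1)]\<close> this gives the width \<open>Suc m\<close> of the segment.
\<close>

lemma path_width_sealed:
  assumes B: "seals s c m B" and R: "set R \<subseteq> half_ladder" "(1, 1) \<in> set R"
  shows "path_width (B @ map (frame s c) R) = Suc m + path_width R"
proof -
  have s: "\<bar>s\<bar> = 1" using B by (simp add: seals_def)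
  define A where "A = fst ` set R"
  have A: "finite A" "1 \<in> A" "\<And>a. a \<in> A \<Longrightarrow> 1 \<le> a"
    using R by (force simp: A_def half_ladder_def)+
  have "fst ` set B = (\<lambda>i. c + s * i) ` {-int m..0}"
  proof -
    have "fst ` set B = (\<lambda>i. c + s * i) ` uminus ` {0..int m}"
      unfolding image_image using B by (simp add: seals_def)
    then show ?thesis by simp
  qed
  moreover have "fst ` frame s c ` set R = (\<lambda>i. c + s * i) ` A"
    by (simp add: A_def image_image frame_def)
  ultimately have "fst ` set (B @ map (frame s c) R) = (\<lambda>i. c + s * i) ` ({-int m..0} \<union> A)"
    by (simp add: image_Un)
  then have "path_width (B @ map (frame s c) R) = nat (Max ({-int m..0} \<union> A) - Min ({-int m..0} \<union> A))"
    using A(1) s by (simp only: path_width_def) (subst width_image; simp)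
  moreover have "Max ({-int m..0} \<union> A) = Max A"
  proof (rule Max_eqI)
    have "1 \<le> Max A" using A by simp
    then show "y \<le> Max A" if "y \<in> {-int m..0} \<union> A" for y
      using that A(1) by auto
    show "Max A \<in> {-int m..0} \<union> A" using Max_in[of A] A(1,2) by blast
  qed (use A in auto)
  moreover have "Min ({-int m..0} \<union> A) = - int m"
    using A by (intro Min_eqI) (auto dest: A(3))
  moreover have "Min A = 1" using A by (intro Min_eqI) auto
  moreover have "1 \<le> Max A" using A by simp
  ultimately show ?thesis
    by (simp add: path_width_def flip: A_def)
qed

lemma prob_trapped_after_sealed:
  assumes C: "C > 0" and B: "seals s c m B" and Q: "Q = B @ [frame s c (1, 1)]"
  shows "measure_pmf.prob (gsaw_from C ladder {} Q n)
      {P. prefix Q P \<and> trapped ladder P \<and> path_length P = path_length Q + n \<and> path_width P = w} =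
    (if path_width Q \<le> w
     then term_prob C half_ladder left_vertices (1, 1) n (w - path_width Q) else 0)"
proof -
  have half: "half_ladder \<subseteq> ladder" "(1, 1) \<in> half_ladder"
    by (auto simp: half_ladder_def ladder_def)
  have wQ: "path_width Q = Suc m"
    using path_width_sealed[OF B, of "[(1, 1)]"] half(2) by (simp add: Q path_width_def)
  let ?X = "{P. prefix Q P \<and> trapped ladder P \<and> path_length P = path_length Q + n \<and> path_width P = w}"
  let ?p = "gsaw C half_ladder left_vertices (1, 1) n"
  have iff: "B @ map (frame s c) R \<in> ?X \<longleftrightarrow>
      trapped half_ladder R \<and> path_length R = n \<and> Suc m + path_width R = w"
    if R: "R \<in> set_pmf ?p" for R
  proof -
    note ne = length_gsaw(1)[OF C half(1) R] and sub = gsaw_path_in[OF C half R]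
    have "prefix Q (B @ map (frame s c) R)"
      using prefix_gsaw_from[OF C order_refl, of "B @ map (frame s c) R" "{}" Q n] R
      by (simp add: Q gsaw_from_sealed[OF C B])
    moreover have "trapped ladder (B @ map (frame s c) R) \<longleftrightarrow> trapped half_ladder R"
      by (simp add: trapped_def unvisited_nbrs_sealed[OF B ne sub(1)])
    moreover have "path_length (B @ map (frame s c) R) = path_length Q + path_length R"
      using ne by (cases R) (auto simp: path_length_def Q)
    ultimately show ?thesis
      by (simp add: path_width_sealed[OF B sub])
  qed
  have "measure_pmf.prob (gsaw_from C ladder {} Q n) ?X
      = measure_pmf.prob ?p ((\<lambda>R. B @ map (frame s c) R) -` ?X)"
    by (simp only: Q gsaw_from_sealed[OF C B] measure_map_pmf)
  also have "\<dots> = measure_pmf.prob ?p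
      {R. trapped half_ladder R \<and> path_length R = n \<and> Suc m + path_width R = w}"
    using iff by (intro measure_pmf.finite_measure_eq_AE) (auto simp: AE_measure_pmf_iff)
  also have "\<dots> = (if Suc m \<le> w then term_prob C half_ladder left_vertices (1, 1) n (w - Suc m) else 0)"
  proof (cases "Suc m \<le> w")
    case True
    then have "Suc m + k = w \<longleftrightarrow> k = w - Suc m" for k by auto
    then show ?thesis using True by (simp add: term_prob_def)
  next
    case False
    then have "{R. trapped half_ladder R \<and> path_length R = n \<and> Suc m + path_width R = w} = {}" by auto
    then show ?thesis using False by simp
  qed
  finally show ?thesis by (simp add: wQ)
qed

section \<open>The shape of hook and twist paths\<close>

text \<open>
  East and west segments are treated uniformly: the columns of a segment in direction \<open>d\<close> are those
  of the east segment multiplied by \<open>heading d\<close>.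
\<close>

fun heading :: "dir \<Rightarrow> int" where
  "heading East = 1"
| "heading West = -1"
| "heading _ = 0"

lemma heading_mirror: "heading (mirror d) = - heading d"
  by (cases d) auto

lemma move_horizontal: "d \<in> {East, West} \<Longrightarrow> move d (a, b) = (a + heading d, b)"
  by (cases d) auto

lemma mirror_horizontal: "d \<in> {East, West} \<Longrightarrow> mirror d \<in> {East, West}"
  by (cases d) auto

lemma path_of_replicate_append:
  assumes "d \<in> {East, West}"
  shows "path_of (a, b) (replicate n d @ ds) =
    map (\<lambda>i. (a + heading d * int i, b)) [0..<n] @ path_of (a + heading d * int n, b) ds"
proof (induction n arbitrary: a)
  case (Suc n)
  have "map (\<lambda>i. (a + heading d * int i, b)) [0..<Suc n]
      = (a, b) # map (\<lambda>i. (a + heading d + heading d * int i, b)) [0..<n]"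
    by (simp add: upt_conv_Cons map_Suc_upt[symmetric] o_def algebra_simps del: upt_Suc)
  then show ?case
    using Suc.IH[of "a + heading d"] by (simp add: move_horizontal[OF assms] algebra_simps)
qed simp

lemma length_path_of: "length (path_of v ds) = Suc (length ds)"
  by (induction ds arbitrary: v) auto

lemma path_of_snoc: "path_of v (ds @ [d]) = path_of v ds @ [move d (last (path_of v ds))]"
proof (induction ds arbitrary: v)
  case (Cons e ds)
  then show ?case by (cases ds) auto
qed simp

lemma prefix_path_ofD:
  "prefix (path_of v ds) (path_of v es) \<Longrightarrow> prefix ds es"
proof (induction ds arbitrary: v es)
  case (Cons d ds)
  then obtain e es' where es: "es = e # es'" by (cases es) (cases v; cases ds; auto)+
  have pre: "prefix (path_of (move d v) ds) (path_of (move e v) es')"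
    using Cons.prems es by simp
  then have "move d v = move e v"
    by (cases ds; cases es') auto
  moreover from this have "d = e"
    by (cases v; cases d; cases e) auto
  ultimately show ?case using Cons.IH pre es by auto
qed simp

lemma segments_hook:
  "segments hook = {path_of (0, 1) (replicate n d @ North # replicate (Suc n) (mirror d)) | d n.
     d \<in> {East, West}}"
proof -
  have "segments hook = (\<Union>n. \<Union>d\<in>{East, West}.
      {path_of (0, 1) (replicate n d @ North # replicate (Suc n) (mirror d))})"
    by (simp add: segments_def hook_def insert_commute)
  then show ?thesis by blast
qed

lemma segments_twist:
  "segments twist = {path_of (0, 1) (replicate (Suc n) d @ [North, d]) | d n. d \<in> {East, West}}"
proof -
  have "segments twist = (\<Union>n. \<Union>d\<in>{East, West}. {path_of (0, 1) (replicate (Suc n) d @ [North, d])})"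
    by (simp add: segments_def twist_def insert_commute)
  then show ?thesis by blast
qed

lemma segment_cases [consumes 1]:
  assumes "Q \<in> segments hook \<union> segments twist"
  obtains (hook) d n where "d \<in> {East, West}"
      "Q = path_of (0, 1) (replicate n d @ North # replicate (Suc n) (mirror d))"
  | (twist) d n where "d \<in> {East, West}" "Q = path_of (0, 1) (replicate (Suc n) d @ [North, d])"
  using assms unfolding segments_hook segments_twist by blast

text \<open>
  A hook of order \<open>n\<close> fills both rows of the columns 0 to \<open>n\<close> and leaves them backwards, through
  column 0.
\<close>

lemma hook_seals:
  assumes d: "d \<in> {East, West}"
  shows "\<exists>B. path_of (0, 1) (replicate n d @ North # replicate (Suc n) (mirror d)) =
      B @ [frame (- heading d) 0 (1, 1)] \<and> seals (- heading d) 0 n B"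
proof -
  have h: "heading d = 1 \<or> heading d = -1" using d by auto
  define B :: "vertex list" where "B = map (\<lambda>i. (heading d * int i, 1)) [0..<Suc n] @
    map (\<lambda>i. (heading d * int n - heading d * int i, 2)) [0..<Suc n]"
  have fstB: "fst ` set B = (\<lambda>i. heading d * i) ` {0..int n}" (is "?l = ?r")
  proof
    show "?l \<subseteq> ?r"
      by (auto simp: B_def simp flip: right_diff_distrib)
    show "?r \<subseteq> ?l"
    proof
      fix x assume "x \<in> ?r"
      then obtain i where "x = heading d * i" "0 \<le> i" "i \<le> int n"
        unfolding image_iff by (auto simp only: atLeastAtMost_iff)
      then have "(x, 1) \<in> set B"
        by (auto simp: B_def intro!: image_eqI[of _ _ "nat i"] simp del: upt_Suc)
      then show "x \<in> ?l" by force
    qed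
  qed
  have "(0, 1) \<in> set B" "(0, 2) \<in> set B"
    by (auto simp: B_def upt_conv_Cons simp del: upt_Suc)
  then have "seals (- heading d) 0 n B"
    using h fstB by (auto simp: seals_def frame_def left_vertices_def)
  moreover have "path_of (0, 1) (replicate n d @ North # replicate (Suc n) (mirror d)) =
      B @ [frame (- heading d) 0 (1, 1)]"
    using path_of_replicate_append[OF mirror_horizontal[OF d], of "heading d * int n" 2 "Suc n" "[]"]
    by (simp add: path_of_replicate_append[OF d] B_def frame_def heading_mirror algebra_simps
        del: replicate_Suc)
  ultimately show ?thesis by blast
qed

text \<open>
  A twist of order \<open>n\<close> leaves forwards, through the column \<open>n + 1\<close> of its turn. This is the only column
  of which it visits both rows.
\<close>

lemma twist_seals:
  assumes d: "d \<in> {East, West}"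
  shows "\<exists>B. path_of (0, 1) (replicate (Suc n) d @ [North, d]) =
      B @ [frame (heading d) (heading d * int (Suc n)) (1, 1)] \<and>
      seals (heading d) (heading d * int (Suc n)) (Suc n) B"
proof -
  have h: "heading d = 1 \<or> heading d = -1" using d by auto
  define B :: "vertex list" where
    "B = map (\<lambda>i. (heading d * int i, 1)) [0..<Suc (Suc n)] @ [(heading d * int (Suc n), 2)]"
  let ?c = "heading d * int (Suc n)"
  have fstB: "fst ` set B = (\<lambda>i. ?c - heading d * i) ` {0..int (Suc n)}" (is "?l = ?r")
  proof
    show "?l \<subseteq> ?r"
    proof
      fix x assume "x \<in> ?l"
      then have "\<exists>i\<le>Suc n. x = heading d * int i"
        unfolding B_def by (auto simp del: upt_Suc simp: less_Suc_eq_le)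
      then obtain i where "i \<le> Suc n" "x = heading d * int i" by blast
      then show "x \<in> ?r"
        by (intro image_eqI[of _ _ "int (Suc n) - int i"]) (auto simp: algebra_simps)
    qed
    show "?r \<subseteq> ?l"
    proof
      fix x assume "x \<in> ?r"
      then obtain i where i: "x = ?c - heading d * i" "0 \<le> i" "i \<le> int (Suc n)"
        unfolding image_iff by (auto simp only: atLeastAtMost_iff)
      then have "(x, 1) \<in> set B"
        by (auto simp: B_def algebra_simps intro!: image_eqI[of _ _ "nat (int (Suc n) - i)"] simp del: upt_Suc)
      then show "x \<in> ?l" by force
    qed
  qed
  have "(?c, 1) \<in> set B" "(?c, 2) \<in> set B"
    by (auto simp: B_def)
  then have "seals (heading d) ?c (Suc n) B"
    using h fstB by (auto simp: seals_def frame_def left_vertices_def)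
  moreover have "path_of (0, 1) (replicate (Suc n) d @ [North, d]) = B @ [frame (heading d) ?c (1, 1)]"
    by (simp add: path_of_replicate_append[OF d] B_def frame_def move_horizontal[OF d] algebra_simps
        del: replicate_Suc)
  ultimately show ?thesis by blast
qed

lemma segment_seals:
  assumes "Q \<in> segments hook \<union> segments twist"
  obtains s c m B where "Q = B @ [frame s c (1, 1)]" "seals s c m B"
  using assms
proof (cases rule: segment_cases)
  case (hook d n)
  then show ?thesis using hook_seals[of d n] that by auto
next
  case (twist d n)
  then show ?thesis using twist_seals[of d n] that by auto
qed

text \<open>
  A segment is determined by the time of its turn north, the direction before the turn and the first
  direction after it. If the turn comes at once, there is no direction before it, but then the
  segment is a hook of order 0 and the direction after the turn is enough. All of these can be read off
  from any longer word.
\<close>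

lemma prefix_turn_eq:
  assumes "prefix (replicate n d @ North # x # r) (replicate n' d' @ North # x' # r')"
    "d \<noteq> North" "d' \<noteq> North"
  shows "n = n' \<and> (n > 0 \<longrightarrow> d = d') \<and> x = x'"
  using assms
proof (induction n arbitrary: n')
  case 0
  then show ?case by (cases n') auto
next
  case (Suc n)
  then obtain k where k: "n' = Suc k" by (cases n') auto
  with Suc show ?case by auto
qed

lemma segments_prefix_free:
  assumes "Q \<in> segments hook \<union> segments twist" "Q' \<in> segments hook \<union> segments twist"
    and "prefix Q Q'"
  shows "Q = Q'"
proof -
  have word: "\<exists>d\<in>{East, West}. \<exists>n x r. Q = path_of (0, 1) (replicate n d @ North # x # r) \<and>
      (x = mirror d \<and> r = replicate n x \<or> x = d \<and> n > 0 \<and> r = [])"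
    if "Q \<in> segments hook \<union> segments twist" for Q
    using that
  proof (cases rule: segment_cases)
    case (hook d n)
    then show ?thesis
      by (intro bexI[of _ d] exI[of _ n] exI[of _ "mirror d"] exI[of _ "replicate n (mirror d)"]) simp_all
  next
    case (twist d n)
    then show ?thesis
      by (intro bexI[of _ d] exI[of _ "Suc n"] exI[of _ d] exI[of _ "[]"]) simp_all
  qed
  obtain d n x r where Q: "d \<in> {East, West}" "Q = path_of (0, 1) (replicate n d @ North # x # r)"
      "x = mirror d \<and> r = replicate n x \<or> x = d \<and> n > 0 \<and> r = []"
    using word[OF assms(1)] by blast
  obtain d' n' x' r' where Q': "d' \<in> {East, West}" "Q' = path_of (0, 1) (replicate n' d' @ North # x' # r')"
      "x' = mirror d' \<and> r' = replicate n' x' \<or> x' = d' \<and> n' > 0 \<and> r' = []"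
    using word[OF assms(2)] by blast
  have "n = n' \<and> (n > 0 \<longrightarrow> d = d') \<and> x = x'"
    using assms(3) Q(1) Q'(1) unfolding Q(2) Q'(2) by (intro prefix_turn_eq) (auto dest: prefix_path_ofD)
  then show ?thesis
    using Q Q' by (cases "n = 0") auto
qed

lemma hook_twist_disjoint: "segments hook \<inter> segments twist = {}"
proof -
  have False if hook: "Q \<in> segments hook" and twist: "Q \<in> segments twist" for Q
  proof -
    obtain d n where d: "d \<in> {East, West}"
        "Q = path_of (0, 1) (replicate n d @ North # mirror d # replicate n (mirror d))"
      using hook unfolding segments_hook replicate_Suc by blast
    obtain d' n' where d': "d' \<in> {East, West}" "Q = path_of (0, 1) (replicate (Suc n') d' @ North # d' # [])"
      using twist unfolding segments_twist by blast
    have "prefix (replicate n d @ North # mirror d # replicate n (mirror d))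
        (replicate (Suc n') d' @ North # d' # [])"
      using d(2) d'(2) by (metis prefix_path_ofD prefix_order.refl)
    from prefix_turn_eq[OF this] d(1) d'(1) show False by auto
  qed
  then show ?thesis by blast
qed

section \<open>Every terminated walk has a first segment\<close>

text \<open>
  The proper prefixes of hooks and twists: straight paths, and paths that have turned and then gone
  back over their trail, but not yet beyond its start.
\<close>

definition unfinished :: "vertex list \<Rightarrow> bool" where
  "unfinished P \<longleftrightarrow> (\<exists>d\<in>{East, West}. \<exists>n. P = path_of (0, 1) (replicate n d) \<or>
     (\<exists>j\<le>n. P = path_of (0, 1) (replicate n d @ North # replicate j (mirror d))))"

lemma straight_path:
  assumes d: "d \<in> {East, West}"
  shows "last (path_of (a, b) (replicate n d)) = (a + heading d * int n, b)"
    and "(x, y) \<in> set (path_of (a, b) (replicate n d)) \<longleftrightarrow>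
      y = b \<and> (\<exists>i\<in>{0..int n}. x = a + heading d * i)"
proof -
  have eq: "path_of (a, b) (replicate n d) = map (\<lambda>i. (a + heading d * int i, b)) [0..<Suc n]"
    using path_of_replicate_append[OF d, of a b n "[]"] by simp
  show "last (path_of (a, b) (replicate n d)) = (a + heading d * int n, b)"
    by (simp add: eq)
  have "{0..int n} = int ` {0..n}" by (simp add: image_int_atLeastAtMost)
  then show "(x, y) \<in> set (path_of (a, b) (replicate n d)) \<longleftrightarrow>
      y = b \<and> (\<exists>i\<in>{0..int n}. x = a + heading d * i)"
    by (auto simp: eq atLeastLessThanSuc_atLeastAtMost simp del: upt_Suc)
qed

lemma turned_path:
  assumes d: "d \<in> {East, West}"
  shows "last (path_of (0, 1) (replicate n d @ North # replicate j (mirror d))) =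
      (heading d * (int n - int j), 2)"
    and "(x, y) \<in> set (path_of (0, 1) (replicate n d @ North # replicate j (mirror d))) \<longleftrightarrow>
      y = 1 \<and> (\<exists>i\<in>{0..int n}. x = heading d * i) \<or>
      y = 2 \<and> (\<exists>i\<in>{0..int j}. x = heading d * (int n - i))"
proof -
  let ?u = "path_of (heading d * int n, 2) (replicate j (mirror d))"
  have eq: "path_of (0, 1) (replicate n d @ North # replicate j (mirror d)) =
      path_of (0, 1) (replicate n d) @ ?u"
    using path_of_replicate_append[OF d, of 0 1 n "[]"]
    by (simp add: path_of_replicate_append[OF d])
  have "?u \<noteq> []" using length_path_of by (metis length_0_conv nat.distinct(1))
  then show "last (path_of (0, 1) (replicate n d @ North # replicate j (mirror d))) =
      (heading d * (int n - int j), 2)"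
    by (simp add: eq straight_path[OF mirror_horizontal[OF d]] heading_mirror algebra_simps)
  show "(x, y) \<in> set (path_of (0, 1) (replicate n d @ North # replicate j (mirror d))) \<longleftrightarrow>
      y = 1 \<and> (\<exists>i\<in>{0..int n}. x = heading d * i) \<or>
      y = 2 \<and> (\<exists>i\<in>{0..int j}. x = heading d * (int n - i))"
    by (simp add: eq straight_path[OF mirror_horizontal[OF d]] straight_path[OF d] heading_mirror
        algebra_simps)
qed

lemma unfinished_not_trapped:
  assumes "unfinished P"
  shows "\<not> trapped ladder P"
proof -
  obtain d n where d: "d \<in> {East, West}" and "P = path_of (0, 1) (replicate n d) \<or>
     (\<exists>j\<le>n. P = path_of (0, 1) (replicate n d @ North # replicate j (mirror d)))"
    using assms unfolding unfinished_def by blast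
  have h: "heading d = 1 \<or> heading d = -1" using d by auto
  from \<open>P = _ \<or> _\<close> have "\<exists>w. w \<in> unvisited_nbrs ladder P"
  proof (elim disjE exE conjE)
    assume P: "P = path_of (0, 1) (replicate n d)"
    then have "(heading d * int n, 2) \<in> unvisited_nbrs ladder P"
      by (auto simp: unvisited_nbrs_def straight_path[OF d] ladder_def)
    then show ?thesis by blast
  next
    fix j assume P: "P = path_of (0, 1) (replicate n d @ North # replicate j (mirror d))"
    (* The next vertex backwards is unvisited also for j = n, where it lies beyond column 0. *)
    have "(heading d * (int n - int j - 1), 2) \<in> unvisited_nbrs ladder P"
      using h by (auto simp: P unvisited_nbrs_def turned_path[OF d] ladder_def)
    then show ?thesis by blast
  qed
  then show ?thesis by (auto simp: trapped_def)
qed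

lemma abs_diff_eq_1: "\<bar>a - b\<bar> = 1 \<longleftrightarrow> b = a + 1 \<or> b = a - 1" for a b :: int
  by auto

text \<open>
  The available steps from a straight path are to go on or to turn. From the start there is also the
  step in the opposite direction, which gives a straight path again. After the turn, the path goes
  back above its trail and completes a hook when it passes column 0. Immediately after the turn
  it can also go forward, which completes a twist or, if it turned at the start, a hook of order 0 in
  the opposite direction.
\<close>

lemma unfinished_step:
  assumes "unfinished P" "w \<in> unvisited_nbrs ladder P"
  shows "unfinished (P @ [w]) \<or> P @ [w] \<in> segments hook \<union> segments twist"
proof -
  obtain d n where d: "d \<in> {East, West}" and P: "P = path_of (0, 1) (replicate n d) \<or>
     (\<exists>j\<le>n. P = path_of (0, 1) (replicate n d @ North # replicate j (mirror d)))"
    using assms unfolding unfinished_def by blast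
  obtain x y where w: "w = (x, y)" by fastforce
  have y: "y = 1 \<or> y = 2" and adj: "ladder_adj (last P) (x, y)" and new: "(x, y) \<notin> set P"
    using assms(2) by (auto simp: w unvisited_nbrs_def ladder_def)
  from P show ?thesis
  proof (elim disjE exE conjE)
    assume P: "P = path_of (0, 1) (replicate n d)"
    have snoc: "P @ [move e (heading d * int n, 1)] = path_of (0, 1) (replicate n d @ [e])" for e
      by (simp add: P path_of_snoc straight_path[OF d])
    consider "w = move d (heading d * int n, 1)" | "w = move (mirror d) (heading d * int n, 1)"
      | "w = move North (heading d * int n, 1)"
      using adj y d by (auto simp: P straight_path[OF d] w abs_diff_eq_1)
    then show ?thesis
    proof cases
      case 1
      then have "P @ [w] = path_of (0, 1) (replicate (Suc n) d)"
        using snoc[of d] by (simp add: replicate_append_same)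
      then show ?thesis using d unfolding unfinished_def by blast
    next
      case 2
      have "n = 0"
      proof (rule ccontr)
        assume "n \<noteq> 0"
        then have "w \<in> set P"
          using 2 by (auto simp: P straight_path[OF d] move_horizontal[OF mirror_horizontal[OF d]]
              heading_mirror algebra_simps intro!: bexI[of _ "int n - 1"])
        then show False using new w by simp
      qed
      then have "P @ [w] = path_of (0, 1) (replicate 1 (mirror d))"
        using 2 snoc[of "mirror d"] by simp
      then show ?thesis using mirror_horizontal[OF d] unfolding unfinished_def by blast
    next
      case 3
      then have "P @ [w] = path_of (0, 1) (replicate n d @ North # replicate 0 (mirror d))"
        using snoc[of North] by simp
      then show ?thesis using d unfolding unfinished_def by blast
    qed
  next
    fix j assume j: "j \<le> n" and P: "P = path_of (0, 1) (replicate n d @ North # replicate j (mirror d))"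
    let ?v = "(heading d * (int n - int j), 2)"
    have snoc: "P @ [move e ?v] = path_of (0, 1) (replicate n d @ North # replicate j (mirror d) @ [e])" for e
      using path_of_snoc[of "(0, 1)" "replicate n d @ North # replicate j (mirror d)" e]
      by (simp add: P turned_path[OF d])
    have "y \<noteq> 1"
    proof
      assume "y = 1"
      then have "(x, y) \<in> set P"
        using adj j by (auto simp: P turned_path[OF d] intro!: bexI[of _ "int n - int j"])
      then show False using new by simp
    qed
    then consider "w = move (mirror d) ?v" | "w = move d ?v"
      using adj y d by (auto simp: P turned_path[OF d] w abs_diff_eq_1 algebra_simps)
    then show ?thesis
    proof cases
      case 1
      then have Pw: "P @ [w] = path_of (0, 1) (replicate n d @ North # replicate (Suc j) (mirror d))"
        using snoc[of "mirror d"] by (simp add: replicate_append_same)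
      show ?thesis
      proof (cases "j = n")
        case True
        then show ?thesis using Pw d unfolding segments_hook by blast
      next
        case False
        then have "Suc j \<le> n" using j by simp
        then show ?thesis using Pw d unfolding unfinished_def by blast
      qed
    next
      case 2
      have "j = 0"
      proof (rule ccontr)
        assume "j \<noteq> 0"
        then have "w \<in> set P"
          (* A path that has stepped back came from the vertex one step forward. *)
          using 2 by (auto simp: P turned_path[OF d] move_horizontal[OF d]
              algebra_simps intro!: bexI[of _ "int j - 1"])
        then show False using new w by simp
      qed
      then have Pw: "P @ [w] = path_of (0, 1) (replicate n d @ [North, d])"
        using 2 snoc[of d] by simp
      show ?thesis
      proof (cases n)
        case 0
        (* The path goes up from the start and then in direction d. As a hook it belongs to the
           opposite direction, because a hook returns in the direction mirror to its outward run. *)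
        have "mirror (mirror d) = d" by (cases d) auto
        then have "P @ [w] = path_of (0, 1)
            (replicate 0 (mirror d) @ North # replicate (Suc 0) (mirror (mirror d)))"
          using Pw 0 by simp
        then show ?thesis using mirror_horizontal[OF d] unfolding segments_hook by blast
      next
        case (Suc k)
        then show ?thesis using Pw d unfolding segments_twist by blast
      qed
    qed
  qed
qed

lemma gsaw_unfinished_or_segment:
  assumes "C > 0" "P \<in> set_pmf (gsaw C ladder {} (0, 1) n)"
  shows "unfinished P \<or> (\<exists>Q \<in> segments hook \<union> segments twist. prefix Q P)"
  using assms(2)
proof (induction n arbitrary: P)
  case 0
  then have "P = path_of (0, 1) (replicate 0 East)" by simp
  then show ?case unfolding unfinished_def by blast
next
  case (Suc n)
  from assms(1) order_refl Suc.prems show ?case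
  proof (cases rule: set_pmf_gsaw_SucE)
    case stay
    then show ?thesis using Suc.IH by blast
  next
    case (move P' w)
    from Suc.IH[OF move(1)] show ?thesis
      using unfinished_step[OF _ move(3)] move(4) by (metis prefix_order.refl prefix_prefix)
  qed
qed

section \<open>Summing over the first segment\<close>

lemma finite_short_segments: "finite {Q \<in> segments hook \<union> segments twist. path_length Q \<le> l}"
proof (rule finite_subset)
  let ?F = "\<lambda>d n. {path_of (0, 1) (replicate n d @ North # replicate (Suc n) (mirror d)),
    path_of (0, 1) (replicate (Suc n) d @ [North, d])}"
  show "{Q \<in> segments hook \<union> segments twist. path_length Q \<le> l}
      \<subseteq> (\<Union>d\<in>{East, West}. \<Union>n\<le>l. ?F d n)"
  proof
    fix Q assume "Q \<in> {Q \<in> segments hook \<union> segments twist. path_length Q \<le> l}"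
    then have "Q \<in> segments hook \<union> segments twist" and l: "path_length Q \<le> l" by simp_all
    from this(1) show "Q \<in> (\<Union>d\<in>{East, West}. \<Union>n\<le>l. ?F d n)"
    proof (cases rule: segment_cases)
      case (hook d n)
      then have "n \<le> l" using l by (simp add: path_length_def length_path_of)
      then show ?thesis using hook by blast
    next
      case (twist d n)
      then have "n \<le> l" using l by (simp add: path_length_def length_path_of)
      then show ?thesis using twist by blast
    qed
  qed
qed auto

lemma length_segment:
  assumes "Q \<in> segments hook \<union> segments twist"
  shows "length Q = Suc (path_length Q)"
  using assms by (auto simp: segments_def path_length_def length_path_of)

text \<open>
  At time \<open>k\<close> no path is longer than \<open>k\<close> steps, so a path that begins with a segment of length \<open>k\<close> is
  this segment.
\<close>

lemma segment_prob_eq_sum: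
  assumes C: "C > 0" and s: "segments s \<subseteq> segments hook \<union> segments twist"
  shows "segment_prob C s k j =
    (\<Sum>Q\<in>{Q \<in> segments s. path_length Q = k \<and> path_width Q = j}. pmf (gsaw C ladder {} (0, 1) k) Q)"
proof -
  let ?A = "{Q \<in> segments s. path_length Q = k \<and> path_width Q = j}"
  have fin: "finite ?A"
    by (rule finite_subset[OF _ finite_short_segments[of k]]) (use s in auto)
  have "(\<exists>Q\<in>segments s. path_length Q = k \<and> path_width Q = j \<and> prefix Q P) \<longleftrightarrow> P \<in> ?A"
    if P: "P \<in> set_pmf (gsaw C ladder {} (0, 1) k)" for P
  proof -
    have "Q = P" if Q: "Q \<in> segments s" "path_length Q = k" "prefix Q P" for Q
    proof -
      have "length P \<le> length Q"
        using length_gsaw(2)[OF C order_refl P] length_segment[of Q] Q s by auto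
      then show ?thesis using Q(3) prefix_length_le prefix_same_cases
        by (auto simp: prefix_def)
    qed
    then show ?thesis by blast
  qed
  then have "segment_prob C s k j = measure_pmf.prob (gsaw C ladder {} (0, 1) k) ?A"
    unfolding segment_prob_def
    by (intro measure_pmf.finite_measure_eq_AE) (auto simp: AE_measure_pmf_iff)
  then show ?thesis using fin by (simp add: measure_measure_pmf_finite)
qed

lemma segment_prob_hook_twist:
  assumes C: "C > 0"
  shows "segment_prob C hook k j + segment_prob C twist k j =
    (\<Sum>Q\<in>{Q \<in> segments hook \<union> segments twist. path_length Q = k \<and> path_width Q = j}.
       pmf (gsaw C ladder {} (0, 1) k) Q)"
proof -
  let ?A = "\<lambda>X. {Q \<in> X. path_length Q = k \<and> path_width Q = j}"
  have "finite (?A (segments hook))" "finite (?A (segments twist))"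
    by (rule finite_subset[OF _ finite_short_segments[of k]]; force)+
  moreover have "?A (segments hook) \<inter> ?A (segments twist) = {}" using hook_twist_disjoint by blast
  moreover have "?A (segments hook \<union> segments twist) = ?A (segments hook) \<union> ?A (segments twist)" by blast
  ultimately show ?thesis
    by (simp add: segment_prob_eq_sum[OF C] sum.union_disjoint)
qed

lemma term_prob_ladder_eq_sum:
  assumes C: "C > 0"
  shows "term_prob C ladder {} (0, 1) l w =
    (\<Sum>Q\<in>{Q \<in> segments hook \<union> segments twist. path_length Q \<le> l}.
       pmf (gsaw C ladder {} (0, 1) (path_length Q)) Q *
       (if path_width Q \<le> w
        then term_prob C half_ladder left_vertices (1, 1) (l - path_length Q) (w - path_width Q)
        else 0))"
proof -
  let ?S = "segments hook \<union> segments twist"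
  let ?Sl = "{Q \<in> ?S. path_length Q \<le> l}"
  let ?p = "gsaw C ladder {} (0, 1) l"
  define E where "E Q = {P. prefix Q P \<and> trapped ladder P \<and> path_length P = l \<and> path_width P = w}" for Q
  have "trapped ladder P \<and> path_length P = l \<and> path_width P = w \<longleftrightarrow> P \<in> (\<Union>Q\<in>?Sl. E Q)"
    if P: "P \<in> set_pmf ?p" for P
  proof
    assume *: "trapped ladder P \<and> path_length P = l \<and> path_width P = w"
    then have "\<not> unfinished P" using unfinished_not_trapped by blast
    then obtain Q where Q: "Q \<in> ?S" "prefix Q P"
      using gsaw_unfinished_or_segment[OF C P] by blast
    moreover have "path_length Q \<le> l"
      using * prefix_length_le[OF Q(2)] by (auto simp: path_length_def)
    ultimately show "P \<in> (\<Union>Q\<in>?Sl. E Q)" using * unfolding E_def by blast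
  qed (auto simp: E_def)
  then have "term_prob C ladder {} (0, 1) l w = measure_pmf.prob ?p (\<Union>Q\<in>?Sl. E Q)"
    unfolding term_prob_def by (intro measure_pmf.finite_measure_eq_AE) (auto simp: AE_measure_pmf_iff)
  also have "\<dots> = (\<Sum>Q\<in>?Sl. measure_pmf.prob ?p (E Q))"
  proof (rule measure_pmf.finite_measure_finite_Union)
    show "disjoint_family_on E ?Sl"
      unfolding disjoint_family_on_def
    proof (intro ballI impI)
      fix Q Q' assume Q: "Q \<in> ?Sl" "Q' \<in> ?Sl" "Q \<noteq> Q'"
      have False if "prefix Q P" "prefix Q' P" for P
        using prefix_same_cases[OF that] segments_prefix_free Q by blast
      then show "E Q \<inter> E Q' = {}" by (auto simp: E_def)
    qed
  qed (use finite_short_segments in auto)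
  also have "\<dots> = (\<Sum>Q\<in>?Sl. pmf (gsaw C ladder {} (0, 1) (path_length Q)) Q *
       (if path_width Q \<le> w
        then term_prob C half_ladder left_vertices (1, 1) (l - path_length Q) (w - path_width Q)
        else 0))"
  proof (rule sum.cong[OF refl])
    fix Q assume Q: "Q \<in> ?Sl"
    then have "Q \<in> ?S" by simp
    then obtain s c m B where B: "Q = B @ [frame s c (1, 1)]" "seals s c m B"
      by (rule segment_seals)
    obtain n where n: "l = path_length Q + n" using Q le_Suc_ex by blast
    have "measure_pmf.prob ?p (E Q) = pmf (gsaw C ladder {} (0, 1) (path_length Q)) Q *
        measure_pmf.prob (gsaw_from C ladder {} Q n) (E Q)"
      unfolding n by (rule prob_gsaw_prefix[OF C order_refl length_segment[OF \<open>Q \<in> ?S\<close>]]) (simp add: E_def)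
    then show "measure_pmf.prob ?p (E Q) = pmf (gsaw C ladder {} (0, 1) (path_length Q)) Q *
       (if path_width Q \<le> w
        then term_prob C half_ladder left_vertices (1, 1) (l - path_length Q) (w - path_width Q)
        else 0)"
      using prob_trapped_after_sealed[OF C B(2,1), of n w] by (simp add: E_def n)
  qed
  finally show ?thesis .
qed

theorem theorem2p59:
  fixes C :: real
  assumes "C > 0"
  shows "ladder_gf C = (hook_gf C + twist_gf C) * half_ladder_star_gf C"
proof (intro fps_ext)
  fix l w
  let ?S = "segments hook \<union> segments twist"
  let ?Sl = "{Q \<in> ?S. path_length Q \<le> l}"
  let ?h = "term_prob C half_ladder left_vertices (1, 1)"
  let ?q = "\<lambda>k. pmf (gsaw C ladder {} (0, 1) k)"
  let ?D = "{Q \<in> ?Sl. path_width Q \<le> w}"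
  let ?A = "\<lambda>k j. {Q \<in> ?S. path_length Q = k \<and> path_width Q = j}"
  have "fps_nth (fps_nth ((hook_gf C + twist_gf C) * half_ladder_star_gf C) l) w =
      (\<Sum>k=0..l. \<Sum>j=0..w. (segment_prob C hook k j + segment_prob C twist k j) * ?h (l - k) (w - j))"
    by (simp add: fps_mult_nth fps_sum_nth hook_gf_def twist_gf_def half_ladder_star_gf_def bivariate_gf_def)
  also have "\<dots> = (\<Sum>k=0..l. \<Sum>j=0..w. \<Sum>Q\<in>?A k j.
      ?q (path_length Q) Q * ?h (l - path_length Q) (w - path_width Q))"
    by (simp add: segment_prob_hook_twist[OF assms] sum_distrib_right)
  also have "\<dots> = (\<Sum>(k, j)\<in>{0..l} \<times> {0..w}. \<Sum>Q\<in>?A k j.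
      ?q (path_length Q) Q * ?h (l - path_length Q) (w - path_width Q))"
    by (simp add: sum.cartesian_product)
  (* Every short segment is counted for exactly one pair of a length and a width. *)
  also have "\<dots> = (\<Sum>p\<in>{0..l} \<times> {0..w}. \<Sum>Q\<in>{Q \<in> ?D. (path_length Q, path_width Q) = p}.
      ?q (path_length Q) Q * ?h (l - path_length Q) (w - path_width Q))"
    by (intro sum.cong refl) (auto intro!: sum.cong)
  also have "\<dots> = (\<Sum>Q\<in>?D. ?q (path_length Q) Q * ?h (l - path_length Q) (w - path_width Q))"
  proof (rule sum.group)
    show "finite ?D" using finite_short_segments[of l] by (rule rev_finite_subset) auto
  qed auto
  also have "\<dots> = (\<Sum>Q\<in>?Sl. ?q (path_length Q) Q *
       (if path_width Q \<le> w then ?h (l - path_length Q) (w - path_width Q) else 0))"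
    using finite_short_segments[of l] by (intro sum.mono_neutral_cong_left) auto
  also have "\<dots> = fps_nth (fps_nth (ladder_gf C) l) w"
    by (simp add: term_prob_ladder_eq_sum[OF assms] ladder_gf_def bivariate_gf_def)
  finally show "fps_nth (fps_nth (ladder_gf C) l) w =
      fps_nth (fps_nth ((hook_gf C + twist_gf C) * half_ladder_star_gf C) l) w" by simp
qed

end
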